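(* Let $X, Y$ be (real) Banach spaces, let $G:X\rightrightarrows Y$ be a convex multifunction whose graph is closed, and let $\varphi:X\times Y\to\overline{\mathbb{R}}$ be a proper closed convex function. Let $\mu: X\to\overline{\mathbb{R}}$, $\mu(x)=\inf\{\varphi(x,y)\mid y\in G(x)\}$, and suppose that $\mu$ is finite at $\bar x\in X$. Assume that either (i) $\mathbb{R}_+(\operatorname{dom}\varphi-\operatorname{gph} G)$ is a closed subspace of $X\times Y$, or (ii) $(0,0)\in\operatorname{int}(\operatorname{dom}\varphi-\operatorname{gph} G)$. Then, for every $\varepsilon\ge 0$, $$\partial_\varepsilon\mu(\bar x)=\bigcap_{\eta>0}\ \bigcap_{y\in M_\eta(\bar x)}\ \bigcup_{(\gamma_1,\gamma_2)\in\Gamma(\eta+\varepsilon)}\Big\{x^*\in X^*\ \Big|\ (x^*,0)\in\partial_{\gamma_1}\varphi(\bar x,y)+N_{\gamma_2}\big((\bar x,y);\operatorname{gph} G\big)\Big\}$$ and also $$\partial_\varepsilon\mu(\bar x)=\bigcap_{\eta>0}\ \bigcup_{y\in Y}\ \bigcup_{(\gamma_1,\gamma_2)\in\Gamma(\eta+\varepsilon)}\Big\{x^*\in X^*\ \Big|\ (x^*,0)\in\partial_{\gamma_1}\varphi(\bar x,y)+N_{\gamma_2}\big((\bar x,y);\operatorname{gph} G\big)\Big\},$$ where $M_\eta(\bar x)=\{y\in G(\bar x)\mid \varphi(\bar x,y)\le\mu(\bar x)+\eta\}$ and $\Gamma(\eta+\varepsilon)=\{(\gamma_1,\gamma_2)\mid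 \gamma_1\ge 0,\ \gamma_2\ge 0,\ \gamma_1+\gamma_2=\eta+\varepsilon\}$.
   Context: $X^*$, $Y^*$ denote the topological duals of $X$, $Y$; the dual of $X\times Y$ is identified with $X^*\times Y^*$ via $\langle (x^*,y^* ),(x,y)\rangle=\langle x^*,x\rangle+\langle y^*,y\rangle$. $\overline{\mathbb{R}}=[-\infty,+\infty]$. For $f:Z\to\overline{\mathbb{R}}$ on a Banach space $Z$: $\operatorname{dom} f=\{z\mid f(z)<+\infty\}$; $f$ is proper if $\operatorname{dom} f\ne\emptyset$ and $f(z)>-\infty$ for all $z$; $f$ is convex (resp. closed) if its epigraph $\{(z,\alpha)\in Z\times\mathbb{R}\mid \alpha\ge f(z)\}$ is convex (resp. closed in $Z\times\mathbb{R}$). For $f$ convex, $\bar z\in\operatorname{dom} f$ and $\varepsilon\ge 0$, the $\varepsilon$-subdifferential is $\partial_\varepsilon f(\bar z)=\{z^*\in Z^*\mid \langle z^*,z-\bar z\rangle\le f(z)-f(\bar z)+\varepsilon\ \ \forall z\in Z\}$. For a nonempty convex set $C\subset Z$, $\bar z\in C$ and $\varepsilon\ge 0$, the set of $\varepsilon$-normal directions is $N_\varepsilon(\bar z;C)=\{z^*\in Z^*\mid\langle z^*,z-\bar z\rangle\le\varepsilon\ \ \forall z\in C\}$. By convention $\partial_\varepsilon f(\bar z)=\emptyset$ if $\bar z\notin\operatorname{dom} f$ and $N_\varepsilon(\bar z;C)=\emptyset$ if $\bar z\notin C$. Sums and differences of sets are taken in the Minkowski sense, $A-B=\{a-b\mid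 a\in A,\ b\in B\}$ (a sum is empty if one summand is empty). $\mathbb{R}_+(A)=\{ta\mid t\ge 0,\ a\in A\}$ is the cone generated by $A$, and $\operatorname{int}$ denotes topological interior. For a multifunction $G:X\rightrightarrows Y$ (assigning to each $x\in X$ a subset $G(x)\subset Y$, possibly empty), $\operatorname{gph} G=\{(x,y)\in X\times Y\mid y\in G(x)\}$; $G$ is convex if $\operatorname{gph} G$ is a convex set. Convention: $\inf\emptyset=+\infty$. *)

theory Defs
  imports "HOL-Analysis.Analysis"
begin

text \<open>
  The topological dual of a real normed space \<open>'z\<close> is the type \<open>'z \<Rightarrow>\<^sub>L real\<close>.
  The sum of two sets is the Minkowski sum of \<^theory>\<open>HOL-Library.Set_Algebras\<close>, but \<open>-\<close> on
  sets is the set-theoretic difference, whence \<open>minkowski_diff\<close> below.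
\<close>

definition dual_pair ::
    "('a::real_normed_vector \<Rightarrow>\<^sub>L real) \<Rightarrow> ('b::real_normed_vector \<Rightarrow>\<^sub>L real) \<Rightarrow> ('a \<times> 'b) \<Rightarrow>\<^sub>L real"
  where "dual_pair xs ys = (xs o\<^sub>L fst_blinfun) + (ys o\<^sub>L snd_blinfun)"

lemma dual_pair_apply: "dual_pair xs ys (x, y) = xs x + ys y"
  by (simp add: dual_pair_def blinfun.add_left)

definition minkowski_diff :: "'z::minus set \<Rightarrow> 'z set \<Rightarrow> 'z set"
  where "minkowski_diff A B = {a - b | a b. a \<in> A \<and> b \<in> B}"

definition generated_cone :: "'z::real_vector set \<Rightarrow> 'z set"
  where "generated_cone A = {t *\<^sub>R a | t a. 0 \<le> t \<and> a \<in> A}"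

definition edom :: "('z \<Rightarrow> ereal) \<Rightarrow> 'z set"
  where "edom f = {z. f z < \<infinity>}"

definition eproper :: "('z \<Rightarrow> ereal) \<Rightarrow> bool"
  where "eproper f \<longleftrightarrow> edom f \<noteq> {} \<and> (\<forall>z. - \<infinity> < f z)"

definition eepigraph :: "('z \<Rightarrow> ereal) \<Rightarrow> ('z \<times> real) set"
  where "eepigraph f = {(z, \<alpha>). f z \<le> ereal \<alpha>}"

definition econvex :: "('z::real_vector \<Rightarrow> ereal) \<Rightarrow> bool"
  where "econvex f \<longleftrightarrow> convex (eepigraph f)"

definition eclosed :: "('z::topological_space \<Rightarrow> ereal) \<Rightarrow> bool"
  where "eclosed f \<longleftrightarrow> closed (eepigraph f)"

definition eps_subdiff ::
    "real \<Rightarrow> ('z::real_normed_vector \<Rightarrow> ereal) \<Rightarrow> 'z \<Rightarrow> ('z \<Rightarrow>\<^sub>L real) set"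
  where "eps_subdiff \<epsilon> f z0 =
    (if z0 \<in> edom f then {zs. \<forall>z. ereal (blinfun_apply zs (z - z0)) \<le> f z - f z0 + ereal \<epsilon>} else {})"

definition eps_normal ::
    "real \<Rightarrow> 'z::real_normed_vector \<Rightarrow> 'z set \<Rightarrow> ('z \<Rightarrow>\<^sub>L real) set"
  where "eps_normal \<epsilon> z0 C =
    (if z0 \<in> C then {zs. \<forall>z\<in>C. blinfun_apply zs (z - z0) \<le> \<epsilon>} else {})"

text \<open>A multifunction from \<open>'a\<close> to \<open>'b\<close> is a function \<open>'a \<Rightarrow> 'b set\<close>.\<close>

definition gph :: "('a \<Rightarrow> 'b set) \<Rightarrow> ('a \<times> 'b) set"
  where "gph G = {(x, y). y \<in> G x}"

definition convex_multifunction :: "('a::real_vector \<Rightarrow> 'b::real_vector set) \<Rightarrow> bool"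
  where "convex_multifunction G \<longleftrightarrow> convex (gph G)"

text \<open>In \<open>ereal\<close> the infimum over the empty set is \<open>\<infinity>\<close>.\<close>

definition marginal :: "('a \<times> 'b \<Rightarrow> ereal) \<Rightarrow> ('a \<Rightarrow> 'b set) \<Rightarrow> 'a \<Rightarrow> ereal"
  where "marginal \<phi> G x = (INF y\<in>G x. \<phi> (x, y))"

definition approx_sol :: "('a \<times> 'b \<Rightarrow> ereal) \<Rightarrow> ('a \<Rightarrow> 'b set) \<Rightarrow> real \<Rightarrow> 'a \<Rightarrow> 'b set"
  where "approx_sol \<phi> G \<eta> x = {y \<in> G x. \<phi> (x, y) \<le> marginal \<phi> G x + ereal \<eta>}"

definition splits :: "real \<Rightarrow> (real \<times> real) set"
  where "splits r = {(\<gamma>\<^sub>1, \<gamma>\<^sub>2). 0 \<le> \<gamma>\<^sub>1 \<and> 0 \<le> \<gamma>\<^sub>2 \<and> \<gamma>\<^sub>1 + \<gamma>\<^sub>2 = r}"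

end

theory Submission
  imports Defs
begin

text \<open>
  Everything rests on a sum rule. If \<open>x*\<close> is an \<open>\<epsilon>\<close>-subgradient of the marginal function at \<open>x0\<close> and
  \<open>y\<close> is an \<open>\<eta>\<close>-solution, then \<open>(x*, 0)\<close> is an \<open>(\<eta> + \<epsilon>)\<close>-subgradient at \<open>(x0, y)\<close> of \<open>\<phi>\<close> plus the
  indicator of the graph, and the sum rule \<open>eps_subdiff_indicator_sum_rule\<close> splits \<open>(x*, 0)\<close> into
  a \<open>\<gamma>\<^sub>1\<close>-subgradient of \<open>\<phi>\<close> and a \<open>\<gamma>\<^sub>2\<close>-normal of the graph. Conversely, adding the two inequalities
  of such a splitting and minimising over \<open>y\<close> gives an \<open>(\<eta> + \<epsilon>)\<close>-subgradient of the marginal function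
  (\<open>eps_subdiff_marginalI\<close>); a single \<open>y\<close> for each \<open>\<eta>\<close> is enough, and \<open>\<eta>\<close> tends to \<open>0\<close>. As \<open>\<eta>\<close>-solutions
  exist, the set with the intersection over \<open>y\<close> lies in the set with the union over \<open>y\<close>, so all
  three sets agree.

  For the sum rule, let \<open>C\<close> be a closed convex set and let \<open>z*\<close> satisfy
  \<open>z*(z - z0) \<le> \<phi> z - \<phi> z0 + \<epsilon>\<close> on \<open>C\<close>. A splitting \<open>z* = v + (z* - v)\<close> of the required kind exists as
  soon as
  \<open>v (z - c) \<le> \<phi> z - \<phi> z0 + \<epsilon> - z*(c - z0)\<close> for all \<open>z\<close> in the domain of \<open>\<phi>\<close> and all \<open>c\<close> in \<open>C\<close>. The
  infimum \<open>p w\<close> of the right-hand side over \<open>z - c = w\<close> is a convex function of \<open>w\<close>, nonnegative at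
  \<open>0\<close>, and \<open>v\<close> has to be a continuous linear minorant of it. By the Hahn-Banach theorem one exists if
  \<open>p w \<ge> - K * norm w\<close> for some \<open>K\<close> (\<open>convex_calm_minorant\<close>), and by convexity this estimate
  follows once \<open>p\<close> is bounded above on a ball of the subspace \<open>L\<close> generated by the domain of \<open>p\<close>.

  The upper bound is where completeness and closedness enter. The differences \<open>z - c\<close> with
  \<open>\<phi> z\<close>, \<open>norm z\<close> and \<open>norm c\<close> at most \<open>n\<close> form convex sets whose multiples exhaust \<open>L\<close>. By Baire's
  theorem the closure of one of them contains a ball of \<open>L\<close>, and, as in the proof of the open mapping
  theorem, a dyadic series shows that the set itself contains the ball of half the radius
  (\<open>absorbing_convex_images_contain_ball\<close>).
\<close>

section \<open>The Hahn-Banach theorem and linear minorants\<close>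

text \<open>
  Homogeneity is asked for only as an inequality and only for positive factors, which is what infima
  of families inherit most directly; equality, and the value \<open>0\<close> at \<open>0\<close>, follow.
\<close>

definition sublinear :: "('z::real_vector \<Rightarrow> real) \<Rightarrow> bool"
  where "sublinear q \<longleftrightarrow> (\<forall>x y. q (x + y) \<le> q x + q y) \<and> (\<forall>t x. 0 < t \<longrightarrow> q (t *\<^sub>R x) \<le> t * q x)"

lemma sublinear_add: "sublinear q \<Longrightarrow> q (x + y) \<le> q x + q y"
  by (simp add: sublinear_def)

lemma sublinear_scaleR:
  assumes "sublinear q" "0 < t"
  shows "q (t *\<^sub>R x) = t * q x"
proof (rule antisym)
  show "q (t *\<^sub>R x) \<le> t * q x" using assms by (simp add: sublinear_def)
  have "q (inverse t *\<^sub>R (t *\<^sub>R x)) \<le> inverse t * q (t *\<^sub>R x)"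
    using assms unfolding sublinear_def by (metis positive_imp_inverse_positive)
  then show "t * q x \<le> q (t *\<^sub>R x)" using assms(2) by (simp add: field_simps)
qed

lemma sublinear_zero: "sublinear q \<Longrightarrow> q 0 = 0"
  using sublinear_scaleR[of q 2 0] by simp

lemma sublinear_ge_uminus: "sublinear q \<Longrightarrow> - q (- x) \<le> q x"
  using sublinear_add[of q x "- x"] sublinear_zero[of q] by simp

text \<open>
  The common core of the three constructions of sublinear functions below: a pointwise infimum is
  sublinear if the competitors at \<open>x\<close> and \<open>y\<close> can be combined to a competitor at \<open>x + y\<close>, and those
  at \<open>x\<close> can be scaled.
\<close>

lemma sublinear_Inf:
  fixes A :: "'z::real_vector \<Rightarrow> real set"
  assumes ne: "\<And>x. A x \<noteq> {}" and bdd: "\<And>x. bdd_below (A x)"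
    and add: "\<And>x y a b. a \<in> A x \<Longrightarrow> b \<in> A y \<Longrightarrow> \<exists>c\<in>A (x + y). c \<le> a + b"
    and scale: "\<And>t x a. 0 < t \<Longrightarrow> a \<in> A x \<Longrightarrow> \<exists>c\<in>A (t *\<^sub>R x). c \<le> t * a"
  shows "sublinear (\<lambda>x. Inf (A x))"
  unfolding sublinear_def
proof (intro conjI allI impI)
  fix x y
  have *: "Inf (A (x + y)) \<le> a + b" if "a \<in> A x" "b \<in> A y" for a b
    using add[OF that] bdd cInf_lower order_trans by metis
  have "Inf (A (x + y)) - b \<le> Inf (A x)" if "b \<in> A y" for b
    using * that by (intro cInf_greatest ne) (simp add: diff_le_eq)
  then have "Inf (A (x + y)) - Inf (A x) \<le> Inf (A y)"
    by (intro cInf_greatest ne) (simp add: algebra_simps)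
  then show "Inf (A (x + y)) \<le> Inf (A x) + Inf (A y)" by simp
next
  fix t :: real and x assume t: "0 < t"
  have "Inf (A (t *\<^sub>R x)) / t \<le> Inf (A x)"
  proof (intro cInf_greatest ne)
    fix a assume "a \<in> A x"
    then have "Inf (A (t *\<^sub>R x)) \<le> t * a"
      using scale[OF t] bdd cInf_lower order_trans by metis
    then show "Inf (A (t *\<^sub>R x)) / t \<le> a" using t by (simp add: field_simps)
  qed
  then show "Inf (A (t *\<^sub>R x)) \<le> t * Inf (A x)" using t by (simp add: field_simps)
qed

text \<open>
  For fixed \<open>y\<close>, the function \<open>x \<mapsto> inf {f (x + t y) - t f y | t \<ge> 0}\<close> is sublinear and below \<open>f\<close>. If \<open>f\<close> is
  minimal, the two coincide, and the competitor \<open>t = 1\<close> gives \<open>f x \<le> f (x + y) - f y\<close>: a minimal sublinear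
  function is also superadditive, hence additive.
\<close>

lemma minimal_sublinear_imp_linear:
  fixes f :: "'z::real_vector \<Rightarrow> real"
  assumes f: "sublinear f"
    and min: "\<And>g. sublinear g \<Longrightarrow> g \<le> f \<Longrightarrow> g = f"
  shows "linear f"
proof -
  have super: "f x + f y \<le> f (x + y)" for x y
  proof -
    define A where "A x = (\<lambda>t. f (x + t *\<^sub>R y) - t * f y) ` {0..}" for x
    have bdd: "bdd_below (A x)" for x
    proof (rule bdd_belowI)
      fix a assume "a \<in> A x"
      then obtain t where t: "0 \<le> t" "a = f (x + t *\<^sub>R y) - t * f y" by (auto simp: A_def)
      have "t * f y = f (t *\<^sub>R y)"
        using t(1) f sublinear_scaleR[of f t y] sublinear_zero[of f] by (cases "t = 0") auto
      also have "\<dots> \<le> f (x + t *\<^sub>R y) + f (- x)"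
        using sublinear_add[OF f, of "x + t *\<^sub>R y" "- x"] by simp
      finally show "- f (- x) \<le> a" using t by simp
    qed
    have in_A: "f (x + t *\<^sub>R y) - t * f y \<in> A x" if "0 \<le> t" for x t
      using that by (auto simp: A_def)
    have "sublinear (\<lambda>x. Inf (A x))"
    proof (rule sublinear_Inf[OF _ bdd])
      show "A x \<noteq> {}" for x by (simp add: A_def)
    next
      fix x x' a b assume "a \<in> A x" "b \<in> A x'"
      then obtain t s where t: "0 \<le> t" "a = f (x + t *\<^sub>R y) - t * f y"
        and s: "0 \<le> s" "b = f (x' + s *\<^sub>R y) - s * f y" by (auto simp: A_def)
      have "f (x + x' + (t + s) *\<^sub>R y) \<le> f (x + t *\<^sub>R y) + f (x' + s *\<^sub>R y)"
        using sublinear_add[OF f, of "x + t *\<^sub>R y" "x' + s *\<^sub>R y"] by (simp add: algebra_simps)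
      then show "\<exists>c\<in>A (x + x'). c \<le> a + b"
        using t s by (intro bexI[OF _ in_A[of "t + s"]]) (auto simp: algebra_simps)
    next
      fix s :: real and x a assume s: "0 < s" and "a \<in> A x"
      then obtain t where t: "0 \<le> t" "a = f (x + t *\<^sub>R y) - t * f y" by (auto simp: A_def)
      have "f (s *\<^sub>R x + (s * t) *\<^sub>R y) = s * f (x + t *\<^sub>R y)"
        using sublinear_scaleR[OF f s, of "x + t *\<^sub>R y"] by (simp add: algebra_simps)
      then have "f (s *\<^sub>R x + (s * t) *\<^sub>R y) - (s * t) * f y = s * a"
        unfolding t(2) by (simp add: right_diff_distrib)
      then show "\<exists>c\<in>A (s *\<^sub>R x). c \<le> s * a"
        using t(1) s by (intro bexI[OF _ in_A[of "s * t"]]) auto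
    qed
    moreover have "Inf (A x) \<le> f x" for x
      using cInf_lower[OF in_A[of 0 x] bdd] by simp
    ultimately have "(\<lambda>x. Inf (A x)) = f"
      by (intro min) (auto simp: le_fun_def)
    then have "f x \<le> f (x + 1 *\<^sub>R y) - 1 * f y"
      using cInf_lower[OF in_A[of 1 x] bdd] by (metis zero_le_one)
    then show ?thesis by simp
  qed
  have add: "f (x + y) = f x + f y" for x y
    using super[of x y] sublinear_add[OF f, of x y] by simp
  have neg: "f (- x) = - f x" for x
    using add[of x "- x"] sublinear_zero[OF f] by simp
  show ?thesis
  proof (rule linearI[OF add])
    fix t :: real and x
    show "f (t *\<^sub>R x) = t *\<^sub>R f x"
      using sublinear_scaleR[OF f, of t x] sublinear_scaleR[OF f, of "- t" x]
        neg[of "t *\<^sub>R x"] sublinear_zero[OF f]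
      by (cases t "0::real" rule: linorder_cases) auto
  qed
qed

text \<open>
  Zorn's lemma yields a minimal sublinear function below \<open>q\<close>, and minimality makes it linear. The
  infimum of a chain of sublinear functions is finite because \<open>- q (- x)\<close> bounds each of them from
  below at \<open>x\<close>.
\<close>

theorem Hahn_Banach_sublinear:
  fixes q :: "'z::real_vector \<Rightarrow> real"
  assumes q: "sublinear q"
  obtains f where "linear f" "\<And>x. f x \<le> q x"
proof -
  define S where "S = {f. sublinear f \<and> f \<le> q}"
  have "\<exists>m\<in>S. \<forall>f\<in>S. m \<ge> f \<longrightarrow> f = m"
  proof (rule predicate_Zorn)
    show "partial_order_on S (relation_of (\<ge>) S)"
      by (rule partial_order_on_relation_ofI) auto
  next
    fix C assume C: "C \<in> Chains (relation_of (\<ge>) S)"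
    show "\<exists>u\<in>S. \<forall>f\<in>C. f \<ge> u"
    proof (cases "C = {}")
      case True
      then show ?thesis using q by (auto simp: S_def)
    next
      case False
      have CS: "sublinear f" "f \<le> q" if "f \<in> C" for f
        using C that by (auto simp: Chains_def relation_of_def S_def)
      have chain: "f \<le> g \<or> g \<le> f" if "f \<in> C" "g \<in> C" for f g
        using C that by (auto simp: Chains_def relation_of_def)
      define A where "A x = (\<lambda>f. f x) ` C" for x
      have bdd: "bdd_below (A x)" for x
      proof (rule bdd_belowI)
        fix a assume "a \<in> A x"
        then obtain f where f: "f \<in> C" "a = f x" by (auto simp: A_def)
        show "- q (- x) \<le> a"
          using sublinear_ge_uminus[OF CS(1)[OF f(1)], of x] CS(2)[OF f(1)] f(2)
          by (smt (verit) le_funD)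
      qed
      have "sublinear (\<lambda>x. Inf (A x))"
      proof (rule sublinear_Inf[OF _ bdd])
        show "A x \<noteq> {}" for x using False by (simp add: A_def)
      next
        fix x y a b assume "a \<in> A x" "b \<in> A y"
        then obtain f g where fg: "f \<in> C" "g \<in> C" "a = f x" "b = g y" by (auto simp: A_def)
        then obtain h where h: "h \<in> C" "h \<le> f" "h \<le> g" using chain by blast
        have "h (x + y) \<le> h x + h y" using sublinear_add[OF CS(1)[OF h(1)]] .
        then have "h (x + y) \<le> a + b" using h fg by (smt (verit) le_funD)
        then show "\<exists>c\<in>A (x + y). c \<le> a + b" using h(1) by (auto simp: A_def)
      next
        fix t :: real and x a assume "0 < t" "a \<in> A x"
        then show "\<exists>c\<in>A (t *\<^sub>R x). c \<le> t * a"
          using sublinear_scaleR[OF CS(1)] by (fastforce simp: A_def)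
      qed
      moreover have low: "Inf (A x) \<le> f x" if "f \<in> C" for f x
        using that by (intro cInf_lower bdd) (auto simp: A_def)
      moreover obtain f where "f \<in> C" using False by blast
      ultimately have "(\<lambda>x. Inf (A x)) \<in> S"
        using CS(2)[of f] by (auto simp: S_def le_fun_def intro: order_trans)
      then show ?thesis using low by (intro bexI[of _ "\<lambda>x. Inf (A x)"]) (auto simp: le_fun_def)
    qed
  qed
  then obtain m where m: "sublinear m" "m \<le> q"
    and min: "\<And>f. sublinear f \<Longrightarrow> f \<le> q \<Longrightarrow> f \<le> m \<Longrightarrow> f = m"
    by (auto simp: S_def)
  have "linear m"
    using m(2) by (intro minimal_sublinear_imp_linear m(1) min) (auto intro: order_trans)
  then show thesis using that m(2) by (simp add: le_fun_def)
qed

text \<open>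
  Let \<open>p\<close> be the lower envelope of \<open>E\<close>. The Hahn-Banach theorem is applied to the largest sublinear
  function below both \<open>p\<close> and \<open>K * norm\<close>, which at \<open>u\<close> is the infimum of
  \<open>t * p w + K * norm (u - t w)\<close> over \<open>t \<ge> 0\<close> and \<open>w\<close>. The lower bound on \<open>p\<close> makes this finite; the
  competitor \<open>t = 0\<close> bounds it by \<open>K * norm u\<close>, which makes a linear minorant continuous; and the
  competitor \<open>t = 1\<close>, \<open>w = u\<close> bounds it by \<open>p u\<close>.
\<close>

lemma convex_calm_minorant:
  fixes E :: "('z::real_normed_vector \<times> real) set"
  assumes conv: "convex E" and K: "0 \<le> K"
    and calm: "\<And>w \<alpha>. (w, \<alpha>) \<in> E \<Longrightarrow> - K * norm w \<le> \<alpha>"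
  obtains v :: "'z \<Rightarrow>\<^sub>L real" where "\<And>w \<alpha>. (w, \<alpha>) \<in> E \<Longrightarrow> v w \<le> \<alpha>"
proof (cases "E = {}")
  case True
  then show ?thesis using that[of 0] by simp
next
  case False
  then obtain w0 \<alpha>0 where E0: "(w0, \<alpha>0) \<in> E" by auto
  define A where
    "A u = {t * \<alpha> + K * norm (u - t *\<^sub>R w) | t w \<alpha>. 0 \<le> t \<and> (w, \<alpha>) \<in> E}" for u
  have in_A: "t * \<alpha> + K * norm (u - t *\<^sub>R w) \<in> A u" if "0 \<le> t" "(w, \<alpha>) \<in> E" for u t w \<alpha>
    using that by (auto simp: A_def)
  have bdd: "bdd_below (A u)" for u
  proof (rule bdd_belowI)
    fix a assume "a \<in> A u"
    then obtain t w \<alpha> where t: "0 \<le> t" "(w, \<alpha>) \<in> E" "a = t * \<alpha> + K * norm (u - t *\<^sub>R w)"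
      by (auto simp: A_def)
    have "norm (t *\<^sub>R w) \<le> norm u + norm (u - t *\<^sub>R w)"
      by (metis norm_minus_commute norm_triangle_sub)
    then have "K * (t * norm w) \<le> K * norm u + K * norm (u - t *\<^sub>R w)"
      using K t(1) by (simp flip: distrib_left add: mult_left_mono)
    moreover have "t * (- K * norm w) \<le> t * \<alpha>"
      by (rule mult_left_mono[OF calm[OF t(2)] t(1)])
    ultimately show "- K * norm u \<le> a" using t(3) by (simp add: algebra_simps)
  qed
  have "sublinear (\<lambda>u. Inf (A u))"
  proof (rule sublinear_Inf[OF _ bdd])
    show "A u \<noteq> {}" for u using in_A[OF _ E0, of 0 u] by auto
  next
    fix x y a b assume "a \<in> A x" "b \<in> A y"
    then obtain t w \<alpha> s z \<beta> where t: "0 \<le> t" "(w, \<alpha>) \<in> E" "a = t * \<alpha> + K * norm (x - t *\<^sub>R w)"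
      and s: "0 \<le> s" "(z, \<beta>) \<in> E" "b = s * \<beta> + K * norm (y - s *\<^sub>R z)"
      by (auto simp: A_def)
    \<comment> \<open>Two competitors are merged through the convex combination with weights proportional to \<open>t\<close> and \<open>s\<close>.\<close>
    obtain p \<gamma> where p: "(p, \<gamma>) \<in> E" "(t + s) *\<^sub>R p = t *\<^sub>R w + s *\<^sub>R z" "(t + s) * \<gamma> = t * \<alpha> + s * \<beta>"
    proof (cases "t + s = 0")
      case True
      then have "t = 0" "s = 0" using t(1) s(1) by auto
      then show ?thesis using that[OF t(2)] by simp
    next
      case False
      have "(t / (t + s)) *\<^sub>R (w, \<alpha>) + (s / (t + s)) *\<^sub>R (z, \<beta>) \<in> E"
        using False t(1) s(1) by (intro convexD[OF conv t(2) s(2)]) (auto simp: add_divide_distrib[symmetric])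
      then show ?thesis
        using False by (intro that[of "(t / (t + s)) *\<^sub>R w + (s / (t + s)) *\<^sub>R z"
              "(t / (t + s)) * \<alpha> + (s / (t + s)) * \<beta>"]) (auto simp: scaleR_add_right distrib_left)
    qed
    have "x + y - (t + s) *\<^sub>R p = (x - t *\<^sub>R w) + (y - s *\<^sub>R z)"
      by (simp add: p(2))
    then have "norm (x + y - (t + s) *\<^sub>R p) \<le> norm (x - t *\<^sub>R w) + norm (y - s *\<^sub>R z)"
      by (simp only: norm_triangle_ineq)
    then have "K * norm (x + y - (t + s) *\<^sub>R p) \<le> K * norm (x - t *\<^sub>R w) + K * norm (y - s *\<^sub>R z)"
      using K by (simp flip: distrib_left add: mult_left_mono)
    then have "(t + s) * \<gamma> + K * norm (x + y - (t + s) *\<^sub>R p) \<le> a + b"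
      unfolding p(3) t(3) s(3) by simp
    then show "\<exists>c\<in>A (x + y). c \<le> a + b"
      using t(1) s(1) by (intro bexI[OF _ in_A[OF _ p(1), of "t + s"]]) auto
  next
    fix s :: real and x a assume s: "0 < s" and "a \<in> A x"
    then obtain t w \<alpha> where t: "0 \<le> t" "(w, \<alpha>) \<in> E" "a = t * \<alpha> + K * norm (x - t *\<^sub>R w)"
      by (auto simp: A_def)
    have "s *\<^sub>R x - (s * t) *\<^sub>R w = s *\<^sub>R (x - t *\<^sub>R w)" by (simp add: algebra_simps)
    then have "(s * t) * \<alpha> + K * norm (s *\<^sub>R x - (s * t) *\<^sub>R w) = s * a"
      using s t(3) by (simp only: norm_scaleR) (simp add: algebra_simps)
    then show "\<exists>c\<in>A (s *\<^sub>R x). c \<le> s * a"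
      using s t(1) by (intro bexI[OF _ in_A[OF _ t(2), of "s * t"]]) auto
  qed
  then obtain f where lin: "linear f" and f: "\<And>u. f u \<le> Inf (A u)"
    using Hahn_Banach_sublinear by blast
  have le: "f u \<le> t * \<alpha> + K * norm (u - t *\<^sub>R w)" if "0 \<le> t" "(w, \<alpha>) \<in> E" for u t w \<alpha>
    using f[of u] cInf_lower[OF in_A[OF that] bdd] by (rule order_trans)
  have ub: "f u \<le> norm u * K" for u using le[OF _ E0, of 0 u] by (simp add: mult.commute)
  have "norm (f u) \<le> norm u * K" for u
    using ub[of u] ub[of "- u"] linear_neg[OF lin, of u] by auto
  then have bl: "bounded_linear f"
    using lin by (intro bounded_linear_intro[where K = K]) (auto simp: linear_add linear_cmul)
  show ?thesis
  proof (rule that[of "Blinfun f"])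
    fix w \<alpha> assume "(w, \<alpha>) \<in> E"
    then show "blinfun_apply (Blinfun f) w \<le> \<alpha>"
      using le[of 1 w \<alpha> w] by (simp add: bounded_linear_Blinfun_apply[OF bl])
  qed
qed

section \<open>Open mapping for convex sets\<close>

text \<open>
  The weights \<open>1/2, 1/4, \<dots>\<close> add up to \<open>1\<close>, so the sum is an infinite convex combination. A partial sum
  falls short of total weight \<open>1\<close>; giving the missing weight \<open>1/2^n\<close> to an arbitrary point of \<open>K\<close> turns
  it into a genuine convex combination with the same limit.
\<close>

lemma dyadic_series_in_convex:
  fixes k :: "nat \<Rightarrow> 'e::banach"
  assumes "convex K" "closed K" "bounded K" and k: "\<And>n. k n \<in> K"
  obtains s where "s \<in> K" "(\<lambda>n. (1 / 2) ^ Suc n *\<^sub>R k n) sums s"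
proof -
  obtain B where B: "\<And>x. x \<in> K \<Longrightarrow> norm x \<le> B"
    using \<open>bounded K\<close> by (auto simp: bounded_iff)
  have "summable (\<lambda>n. (1 / 2) ^ n * (B / 2))"
    by (intro summable_mult2 summable_geometric) simp
  then have "summable (\<lambda>n. (1 / 2) ^ Suc n *\<^sub>R k n)"
    by (rule summable_comparison_test'[where N = 0]) (simp add: B k)
  then obtain s where s: "(\<lambda>n. (1 / 2) ^ Suc n *\<^sub>R k n) sums s"
    by (auto simp: summable_def)
  have part: "(\<Sum>i<n. (1 / 2) ^ Suc i *\<^sub>R k i) + (1 / 2) ^ n *\<^sub>R c \<in> K" if "c \<in> K" for n c
    using that
  proof (induction n arbitrary: c)
    case 0
    then show ?case by simp
  next
    case (Suc n)
    have "(1 / 2) *\<^sub>R k n + (1 / 2) *\<^sub>R c \<in> K"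
      using Suc.prems k by (intro convexD[OF \<open>convex K\<close>]) auto
    from Suc.IH[OF this] show ?case by (simp add: algebra_simps)
  qed
  have "(\<lambda>n. (1 / 2::real) ^ n) \<longlonglongrightarrow> 0"
    by (intro LIMSEQ_power_zero) simp
  then have "(\<lambda>n. (\<Sum>i<n. (1 / 2) ^ Suc i *\<^sub>R k i) + (1 / 2) ^ n *\<^sub>R k 0) \<longlonglongrightarrow> s + 0 *\<^sub>R k 0"
    using s unfolding sums_def by (intro tendsto_add tendsto_scaleR tendsto_const)
  then have "(\<lambda>n. (\<Sum>i<n. (1 / 2) ^ Suc i *\<^sub>R k i) + (1 / 2) ^ n *\<^sub>R k 0) \<longlonglongrightarrow> s" by simp
  then have "s \<in> K"
    by (rule closed_sequentially[OF \<open>closed K\<close> part[OF k]])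
  then show ?thesis using s that by blast
qed

text \<open>
  The successive approximation of the open mapping theorem: \<open>x = 2 u\<close> is approximated by some \<open>T k\<close>
  with an error below \<open>r / 2\<close>, twice the error lies again in the ball, and so on. This represents \<open>u\<close>
  as the dyadic series of the points \<open>T k\<close>, and the corresponding series of the points \<open>k\<close> converges
  in \<open>K\<close>. The halving of the radius reflects that the weights of the series start with \<open>1/2\<close>.
\<close>

lemma convex_image_contains_half_ball:
  fixes T :: "'e::banach \<Rightarrow> 'f::real_normed_vector"
  assumes K: "convex K" "closed K" "bounded K" and T: "bounded_linear T"
    and L: "subspace L" "T ` K \<subseteq> L" and r: "0 < r"
    and dense: "L \<inter> ball 0 r \<subseteq> closure (T ` K)"
  shows "L \<inter> ball 0 (r / 2) \<subseteq> T ` K"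
proof
  fix u assume u: "u \<in> L \<inter> ball 0 (r / 2)"
  let ?B = "L \<inter> ball 0 r"
  have "\<exists>k\<in>K. 2 *\<^sub>R (x - T k) \<in> ?B" if x: "x \<in> ?B" for x
  proof -
    have "x \<in> closure (T ` K)" using dense x by blast
    then have "\<exists>y\<in>T ` K. dist y x < r / 2"
      unfolding closure_approachable using half_gt_zero[OF r] by blast
    then obtain k where k: "k \<in> K" "dist (T k) x < r / 2" by blast
    have "x - T k \<in> L" using L k(1) x by (auto intro: subspace_diff)
    then show ?thesis
      using k L(1) by (intro bexI[of _ k]) (auto simp: subspace_scale dist_norm norm_minus_commute)
  qed
  then obtain g where g: "\<And>x. x \<in> ?B \<Longrightarrow> g x \<in> K \<and> 2 *\<^sub>R (x - T (g x)) \<in> ?B" by metis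
  define x where "x = rec_nat (2 *\<^sub>R u) (\<lambda>_ x. 2 *\<^sub>R (x - T (g x)))"
  have x0: "x 0 = 2 *\<^sub>R u" and xS: "x (Suc n) = 2 *\<^sub>R (x n - T (g (x n)))" for n
    by (simp_all add: x_def)
  have xB: "x n \<in> ?B" for n
  proof (induction n)
    case 0
    then show ?case using u L(1) by (auto simp: x0 subspace_scale)
  next
    case (Suc n)
    then show ?case using g by (simp only: xS)
  qed
  obtain s where s: "s \<in> K" "(\<lambda>n. (1 / 2) ^ Suc n *\<^sub>R g (x n)) sums s"
    using dyadic_series_in_convex[OF K, of "\<lambda>n. g (x n)"] g xB by blast
  interpret T: bounded_linear T by fact
  have sT: "(\<lambda>n. (1 / 2) ^ Suc n *\<^sub>R T (g (x n))) sums T s"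
    using T.sums[OF s(2)] by (simp only: T.scaleR)
  have "(\<Sum>i<n. (1 / 2) ^ Suc i *\<^sub>R T (g (x i))) = u - (1 / 2) ^ Suc n *\<^sub>R x n" for n
    by (induction n) (auto simp: x0 xS algebra_simps)
  moreover have "(\<lambda>n. (1 / 2) ^ Suc n *\<^sub>R x n) \<longlonglongrightarrow> 0"
  proof (rule Lim_null_comparison)
    show "\<forall>\<^sub>F n in sequentially. norm ((1 / 2) ^ Suc n *\<^sub>R x n) \<le> (1 / 2) ^ Suc n * r"
      using xB by (intro always_eventually allI) (simp add: less_imp_le)
    have "(\<lambda>n. (1 / 2::real) ^ Suc n * r) \<longlonglongrightarrow> 0 * r"
      by (intro tendsto_mult_right LIMSEQ_Suc LIMSEQ_power_zero) simp
    then show "(\<lambda>n. (1 / 2::real) ^ Suc n * r) \<longlonglongrightarrow> 0" by simp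
  qed
  then have "(\<lambda>n. u - (1 / 2) ^ Suc n *\<^sub>R x n) \<longlonglongrightarrow> u - 0" by (intro tendsto_intros)
  ultimately have "(\<lambda>n. (1 / 2) ^ Suc n *\<^sub>R T (g (x n))) sums u" by (simp add: sums_def)
  then have "u = T s" using sT sums_unique2 by blast
  then show "u \<in> T ` K" using s(1) by blast
qed

text \<open>
  A version of the open mapping theorem for an exhausting sequence of closed convex sets. The factors
  \<open>Suc n\<close> in place of \<open>n\<close> keep the multiples nondegenerate.
\<close>

lemma absorbing_convex_images_contain_ball:
  fixes T :: "'e::banach \<Rightarrow> 'f::banach"
  assumes K: "\<And>n. convex (K n)" "\<And>n. closed (K n)" "\<And>n. bounded (K n)" and mono: "mono K"
    and T: "bounded_linear T"
    and L: "subspace L" "closed L" "\<And>n. T ` K n \<subseteq> L"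
    and absorb: "\<And>w. w \<in> L \<Longrightarrow> \<exists>n. w \<in> (*\<^sub>R) (real (Suc n)) ` T ` K n"
  obtains n r where "0 < r" "L \<inter> ball 0 r \<subseteq> T ` K n"
proof -
  define A where "A n = (*\<^sub>R) (real (Suc n)) ` closure (T ` K n)" for n
  have clA: "closed (A n)" for n unfolding A_def by (intro closed_scaling) simp
  have clL: "closure (T ` K n) \<subseteq> L" for n using L by (intro closure_minimal)
  have AL: "A n \<subseteq> L" for n using clL[of n] L(1) by (auto simp: A_def subspace_scale)
  have "\<Union>(range A) = L"
    using AL absorb closure_subset unfolding A_def by fast
  then have "top_of_set L interior_of \<Union>(range A) = L"
    using interior_of_topspace[of "top_of_set L"] by simp
  moreover have "L \<noteq> {}" using subspace_0[OF L(1)] by blast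
  moreover have "completely_metrizable_space (top_of_set L)"
    using L(2) by (intro completely_metrizable_space_closedin completely_metrizable_space_euclidean) simp
  moreover have "closedin (top_of_set L) (A n)" for n
    using AL clA by (rule closed_subset)
  ultimately obtain n where "top_of_set L interior_of (A n) \<noteq> {}"
    using Baire_category_alt[of "top_of_set L" "range A"] by force
  then obtain b U where "openin (top_of_set L) U" "b \<in> U" "U \<subseteq> A n"
    by (auto simp: interior_of_def)
  then obtain e where b: "b \<in> L" "0 < e" "L \<inter> ball b e \<subseteq> A n"
    unfolding openin_contains_ball by blast
  \<comment> \<open>Some set of the sequence contains a positive multiple of \<open>- b\<close>; a convex combination with it
    moves the ball around \<open>b\<close> to a ball around \<open>0\<close>.\<close>
  have "- b \<in> L" using L(1) b(1) by (rule subspace_neg)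
  then obtain m d where d: "d \<in> T ` K m" "- b = real (Suc m) *\<^sub>R d" using absorb by blast
  define N where "N = max n m"
  have sub: "T ` K n \<subseteq> T ` K N" "T ` K m \<subseteq> T ` K N"
    unfolding N_def by (intro image_mono monoD[OF mono] max.cobounded1 max.cobounded2)+
  define p where "p = real (Suc n) + real (Suc m)"
  have p: "0 < p" by (simp add: p_def)
  have "L \<inter> ball 0 (e / p) \<subseteq> closure (T ` K N)"
  proof
    fix u assume u: "u \<in> L \<inter> ball 0 (e / p)"
    have "b + p *\<^sub>R u \<in> L \<inter> ball b e"
      using u p b(1) L(1) by (auto simp: subspace_add subspace_scale dist_norm field_simps)
    then obtain q where q: "q \<in> closure (T ` K n)" "b + p *\<^sub>R u = real (Suc n) *\<^sub>R q"
      using b(3) by (auto simp: A_def)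
    have "(real (Suc n) / p) *\<^sub>R q + (real (Suc m) / p) *\<^sub>R d \<in> closure (T ` K N)"
    proof (rule convexD)
      show "convex (closure (T ` K N))"
        using K(1) T by (intro convex_closure convex_linear_image bounded_linear.linear)
      show "q \<in> closure (T ` K N)" using q(1) closure_mono[OF sub(1)] by blast
      show "d \<in> closure (T ` K N)" using d(1) sub(2) closure_subset by blast
    qed (use p in \<open>auto simp: p_def add_divide_distrib[symmetric]\<close>)
    moreover have "(real (Suc n) / p) *\<^sub>R q + (real (Suc m) / p) *\<^sub>R d
        = (1 / p) *\<^sub>R (real (Suc n) *\<^sub>R q + real (Suc m) *\<^sub>R d)"
      by (simp add: scaleR_add_right)
    moreover have "\<dots> = u" unfolding q(2)[symmetric] d(2)[symmetric] using p by simp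
    ultimately show "u \<in> closure (T ` K N)" by simp
  qed
  then have "L \<inter> ball 0 (e / p / 2) \<subseteq> T ` K N"
    using b(2) p by (intro convex_image_contains_half_ball K T L) auto
  then show ?thesis using b(2) p by (intro that[of "e / p / 2"]) auto
qed

section \<open>Extended real convex functions and generated cones\<close>

text \<open>
  Testing against the points of the epigraph replaces extended real arithmetic by real arithmetic and
  handles the values \<open>\<infinity>\<close> and \<open>- \<infinity>\<close> of \<open>f\<close> uniformly.
\<close>

lemma eps_subdiff_epigraph_iff:
  assumes "f z0 = ereal a"
  shows "zs \<in> eps_subdiff \<epsilon> f z0 \<longleftrightarrow> (\<forall>z \<alpha>. f z \<le> ereal \<alpha> \<longrightarrow> blinfun_apply zs (z - z0) \<le> \<alpha> - a + \<epsilon>)"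
proof -
  have "ereal b \<le> f z - ereal a + ereal \<epsilon> \<longleftrightarrow> (\<forall>\<alpha>. f z \<le> ereal \<alpha> \<longrightarrow> b \<le> \<alpha> - a + \<epsilon>)" for b z
  proof (cases "f z")
    case (real r)
    then show ?thesis by (auto intro: order_trans)
  next
    case MInf
    then show ?thesis by (auto simp: not_le intro!: exI[of _ "b + a - \<epsilon> - 1"])
  qed simp
  then show ?thesis using assms by (simp add: eps_subdiff_def edom_def)
qed

lemma convex_sublevel:
  assumes "econvex f"
  shows "convex {z. f z \<le> ereal r}"
proof (rule convexI)
  fix x y and u v :: real
  assume *: "x \<in> {z. f z \<le> ereal r}" "y \<in> {z. f z \<le> ereal r}" "0 \<le> u" "0 \<le> v" "u + v = 1"
  have "u *\<^sub>R (x, r) + v *\<^sub>R (y, r) \<in> eepigraph f"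
    using * assms by (intro convexD) (auto simp: econvex_def eepigraph_def)
  moreover have "u * r + v * r = r" using *(5) by (simp flip: distrib_right)
  ultimately show "u *\<^sub>R x + v *\<^sub>R y \<in> {z. f z \<le> ereal r}" by (simp add: eepigraph_def)
qed

lemma closed_sublevel:
  assumes "eclosed f"
  shows "closed {z. f z \<le> ereal r}"
proof -
  have "closed ((\<lambda>z. (z, r)) -` eepigraph f)"
    using assms by (intro closed_vimage continuous_intros) (simp add: eclosed_def)
  then show ?thesis by (simp add: eepigraph_def vimage_def)
qed

lemma generated_cone_eq_UNIV:
  fixes A :: "'z::real_normed_vector set"
  assumes "0 \<in> interior A"
  shows "generated_cone A = UNIV"
proof -
  obtain e where e: "0 < e" "ball 0 e \<subseteq> A" using assms mem_interior by blast
  have "w \<in> generated_cone A" for w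
  proof -
    define t where "t = (norm w + 1) / e"
    have t: "0 < t" using e(1) by (simp add: t_def add_nonneg_pos)
    have "norm (inverse t *\<^sub>R w) < e"
      using e(1) t by (simp add: t_def field_simps)
    then have "inverse t *\<^sub>R w \<in> A" using e(2) by auto
    moreover have "w = t *\<^sub>R (inverse t *\<^sub>R w)" using t by simp
    ultimately show ?thesis unfolding generated_cone_def using t by (blast intro: less_imp_le)
  qed
  then show ?thesis by blast
qed

lemma subset_generated_cone: "A \<subseteq> generated_cone A"
proof
  fix a assume "a \<in> A"
  then have "1 *\<^sub>R a \<in> generated_cone A"
    unfolding generated_cone_def using zero_le_one by blast
  then show "a \<in> generated_cone A" by simp
qed

lemma edomI: "f z \<le> ereal r \<Longrightarrow> z \<in> edom f"
  by (auto simp: edom_def)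

lemma minkowski_diffI: "a \<in> A \<Longrightarrow> b \<in> B \<Longrightarrow> a - b \<in> minkowski_diff A B"
  unfolding minkowski_diff_def by blast

section \<open>The sum rule under the qualification condition\<close>

text \<open>
  Every small \<open>w\<close> in the cone generated by \<open>dom \<phi> - C\<close> is a difference \<open>z - c\<close> in which both \<open>\<phi> z\<close>
  and \<open>c\<close> stay bounded. This is the quantitative content of the qualification condition. That
  multiples of the truncated difference sets exhaust \<open>L\<close> uses the common point \<open>z0\<close>: a small factor
  \<open>l\<close> in front of \<open>z - c\<close> is absorbed by moving \<open>z\<close> and \<open>c\<close> towards \<open>z0\<close>.
\<close>

lemma difference_ball_in_cone:
  fixes \<phi> :: "'z::banach \<Rightarrow> ereal" and C :: "'z set"
  assumes C: "convex C" "closed C" and \<phi>: "eproper \<phi>" "eclosed \<phi>" "econvex \<phi>"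
    and z0: "z0 \<in> C" "z0 \<in> edom \<phi>"
    and L: "L = generated_cone (minkowski_diff (edom \<phi>) C)" "subspace L" "closed L"
  obtains r M where "0 < r"
    "\<And>w. w \<in> L \<Longrightarrow> norm w < r \<Longrightarrow> \<exists>z c. \<phi> z \<le> ereal M \<and> c \<in> C \<and> norm c \<le> M \<and> w = z - c"
proof -
  define K where "K n = ({z. \<phi> z \<le> ereal (real n)} \<inter> cball 0 (real n)) \<times> (C \<inter> cball 0 (real n))" for n
  let ?T = "\<lambda>(z, c). z - c :: 'z"
  have T: "bounded_linear ?T"
    unfolding case_prod_unfold by (intro bounded_linear_intros)
  have convK: "convex (K n)" for n
    using C \<phi> unfolding K_def by (intro convex_Times convex_Int convex_sublevel convex_cball)
  have clK: "closed (K n)" for n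
    using C \<phi> unfolding K_def by (intro closed_Times closed_Int closed_sublevel closed_cball)
  have bdK: "bounded (K n)" for n
    unfolding K_def by (intro bounded_Times bounded_Int disjI2 bounded_cball)
  have monoK: "mono K"
    by (rule monoI) (force simp: K_def intro: order_trans)
  have fin: "\<exists>a. \<phi> z = ereal a" if "z \<in> edom \<phi>" for z
    using that \<phi>(1) by (cases "\<phi> z") (auto simp: edom_def eproper_def)
  have TL: "?T ` K n \<subseteq> L" for n
  proof clarify
    fix z c assume "(z, c) \<in> K n"
    then have "z - c \<in> minkowski_diff (edom \<phi>) C"
      by (intro minkowski_diffI edomI[of \<phi> z "real n"]) (auto simp: K_def)
    then show "z - c \<in> L" unfolding L(1) using subset_generated_cone by blast
  qed
  have inK: "\<exists>n. (z, c) \<in> K n" if zc: "z \<in> edom \<phi>" "c \<in> C" for z c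
  proof -
    obtain a where a: "\<phi> z = ereal a" using fin[OF zc(1)] by blast
    obtain n :: nat where "max a (max (norm z) (norm c)) \<le> real n" using real_arch_simple by blast
    then show ?thesis using a zc by (auto simp: K_def)
  qed
  have absorb: "\<exists>n. w \<in> (*\<^sub>R) (real (Suc n)) ` ?T ` K n" if w: "w \<in> L" for w
  proof -
    obtain t z c where t: "0 \<le> t" and z: "z \<in> edom \<phi>" "c \<in> C" and w: "w = t *\<^sub>R (z - c)"
      using w unfolding L(1) generated_cone_def minkowski_diff_def by blast
    obtain n1 where n1: "(z, c) \<in> K n1" using inK[OF z] by blast
    obtain n2 where n2: "(z0, z0) \<in> K n2" using inK[OF z0(2,1)] by blast
    obtain n3 :: nat where n3: "t \<le> real n3" using real_arch_simple by blast
    define n where "n = max n1 (max n2 n3)"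
    define l where "l = t / real (Suc n)"
    have l: "0 \<le> l" "l \<le> 1" using t n3 by (auto simp: l_def n_def field_simps)
    have "n1 \<le> n" "n2 \<le> n" by (simp_all add: n_def)
    then have "(z, c) \<in> K n" "(z0, z0) \<in> K n"
      using n1 n2 monoD[OF monoK] by blast+
    then have "l *\<^sub>R (z, c) + (1 - l) *\<^sub>R (z0, z0) \<in> K n"
      using l by (intro convexD[OF convK]) auto
    then have "?T (l *\<^sub>R (z, c) + (1 - l) *\<^sub>R (z0, z0)) \<in> ?T ` K n" by (rule imageI)
    moreover have "?T (l *\<^sub>R (z, c) + (1 - l) *\<^sub>R (z0, z0)) = l *\<^sub>R (z - c)"
      by (simp add: algebra_simps)
    moreover have "w = real (Suc n) *\<^sub>R (l *\<^sub>R (z - c))"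
      by (simp add: w l_def)
    ultimately show ?thesis by (metis imageI)
  qed
  obtain n r where r: "0 < r" "L \<inter> ball 0 r \<subseteq> ?T ` K n"
    by (rule absorbing_convex_images_contain_ball[of K ?T L, OF convK clK bdK monoK T L(2,3) TL absorb])
  show ?thesis
  proof (rule that[OF r(1)])
    fix w assume "w \<in> L" "norm w < r"
    then have "w \<in> ?T ` K n" using r(2) by auto
    then show "\<exists>z c. \<phi> z \<le> ereal (real n) \<and> c \<in> C \<and> norm c \<le> real n \<and> w = z - c"
      by (auto simp: K_def)
  qed
qed

text \<open>
  The set \<open>E\<close> of the proof lies between the strict epigraph and the epigraph of the infimum \<open>p w\<close> of
  \<open>\<phi> z - a + \<epsilon> - zs (c - z0)\<close> over \<open>z - c = w\<close>, \<open>c\<close> in \<open>C\<close>. Given a continuous linear minorant \<open>v\<close> of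
  \<open>p\<close>, the number \<open>\<gamma>\<close> is the smallest one for which \<open>v\<close> is a \<open>\<gamma>\<close>-subgradient of \<open>\<phi>\<close>, and the
  minorant inequality says that what remains of \<open>\<epsilon>\<close> suffices for the normal direction.
\<close>

theorem eps_subdiff_indicator_sum_rule:
  fixes \<phi> :: "'z::banach \<Rightarrow> ereal" and C :: "'z set" and zs :: "'z \<Rightarrow>\<^sub>L real"
  assumes C: "convex C" "closed C" and \<phi>: "eproper \<phi>" "eclosed \<phi>" "econvex \<phi>"
    and z0: "z0 \<in> C" "\<phi> z0 = ereal a"
    and L: "subspace (generated_cone (minkowski_diff (edom \<phi>) C))"
      "closed (generated_cone (minkowski_diff (edom \<phi>) C))"
    and zs: "\<And>z \<alpha>. z \<in> C \<Longrightarrow> \<phi> z \<le> ereal \<alpha> \<Longrightarrow> zs (z - z0) \<le> \<alpha> - a + \<epsilon>"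
  obtains \<gamma>\<^sub>1 \<gamma>\<^sub>2 where "(\<gamma>\<^sub>1, \<gamma>\<^sub>2) \<in> splits \<epsilon>" "zs \<in> eps_subdiff \<gamma>\<^sub>1 \<phi> z0 + eps_normal \<gamma>\<^sub>2 z0 C"
proof -
  define L where "L = generated_cone (minkowski_diff (edom \<phi>) C)"
  have z0dom: "z0 \<in> edom \<phi>" using z0(2) by (simp add: edom_def)
  define E where "E = {(z - c, \<alpha> - a + \<epsilon> - zs (c - z0)) | z c \<alpha>. \<phi> z \<le> ereal \<alpha> \<and> c \<in> C}"
  have in_E: "(z - c, \<alpha> - a + \<epsilon> - zs (c - z0)) \<in> E" if "\<phi> z \<le> ereal \<alpha>" "c \<in> C" for z c \<alpha>
    using that by (auto simp: E_def)
  have "convex E"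
  proof (rule convexI)
    fix p q and u v :: real
    assume "p \<in> E" "q \<in> E" and uv: "0 \<le> u" "0 \<le> v" "u + v = 1"
    then obtain z c \<alpha> z' c' \<alpha>' where
      p: "\<phi> z \<le> ereal \<alpha>" "c \<in> C" "p = (z - c, \<alpha> - a + \<epsilon> - zs (c - z0))" and
      q: "\<phi> z' \<le> ereal \<alpha>'" "c' \<in> C" "q = (z' - c', \<alpha>' - a + \<epsilon> - zs (c' - z0))"
      by (auto simp: E_def)
    have "u *\<^sub>R (z, \<alpha>) + v *\<^sub>R (z', \<alpha>') \<in> eepigraph \<phi>"
      using p q uv \<phi>(3) by (intro convexD) (auto simp: econvex_def eepigraph_def)
    then have ep: "\<phi> (u *\<^sub>R z + v *\<^sub>R z') \<le> ereal (u * \<alpha> + v * \<alpha>')" by (simp add: eepigraph_def)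
    have cc: "u *\<^sub>R c + v *\<^sub>R c' \<in> C" using p q uv by (intro convexD[OF C(1)])
    have v: "v = 1 - u" using uv(3) by simp
    have "u *\<^sub>R p + v *\<^sub>R q = ((u *\<^sub>R z + v *\<^sub>R z') - (u *\<^sub>R c + v *\<^sub>R c'),
        (u * \<alpha> + v * \<alpha>') - a + \<epsilon> - zs ((u *\<^sub>R c + v *\<^sub>R c') - z0))"
      unfolding p(3) q(3) v by (simp add: algebra_simps blinfun.bilinear_simps)
    then show "u *\<^sub>R p + v *\<^sub>R q \<in> E" using in_E[OF ep cc] by simp
  qed
  have zero: "0 \<le> \<alpha>" if "(0, \<alpha>) \<in> E" for \<alpha>
    using that zs by (fastforce simp: E_def)
  obtain r M where r: "0 < r" and
    ball: "\<And>w. w \<in> L \<Longrightarrow> norm w < r \<Longrightarrow> \<exists>z c. \<phi> z \<le> ereal M \<and> c \<in> C \<and> norm c \<le> M \<and> w = z - c"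
    by (rule difference_ball_in_cone[OF C \<phi> z0(1) z0dom L_def L[folded L_def]]) (rule that; blast)
  define B where "B = \<bar>M\<bar> + \<bar>a\<bar> + \<bar>\<epsilon>\<bar> + norm zs * (\<bar>M\<bar> + norm z0)"
  have B: "0 \<le> B" by (simp add: B_def)
  have bound: "\<exists>\<beta>. (w, \<beta>) \<in> E \<and> \<beta> \<le> B" if w: "w \<in> L" "norm w < r" for w
  proof -
    obtain z c where zc: "\<phi> z \<le> ereal M" "c \<in> C" "norm c \<le> M" "w = z - c" using ball[OF w] by blast
    have "\<bar>zs (c - z0)\<bar> \<le> norm zs * norm (c - z0)" using norm_blinfun[of zs "c - z0"] by simp
    also have "\<dots> \<le> norm zs * (\<bar>M\<bar> + norm z0)"
      using zc(3) norm_triangle_ineq4[of c z0] by (intro mult_left_mono) auto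
    finally have "M - a + \<epsilon> - zs (c - z0) \<le> B" by (simp add: B_def)
    then show ?thesis using in_E[OF zc(1,2)] zc(4) by blast
  qed
  have E_L: "w \<in> L" if "(w, \<alpha>) \<in> E" for w \<alpha>
  proof -
    have "w \<in> minkowski_diff (edom \<phi>) C"
      using that by (auto simp: E_def intro!: minkowski_diffI edomI)
    then show ?thesis unfolding L_def using subset_generated_cone by blast
  qed
  have calm: "- (2 * B / r) * norm w \<le> \<alpha>" if w: "(w, \<alpha>) \<in> E" for w \<alpha>
  proof (cases "w = 0")
    case True
    then show ?thesis using zero w by simp
  next
    case False
    \<comment> \<open>The point \<open>- t w\<close> lies in the ball of radius \<open>r\<close>, where the bound \<open>B\<close> applies, and \<open>0\<close> is a
      convex combination of \<open>w\<close> and \<open>- t w\<close>.\<close>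
    define t where "t = r / (2 * norm w)"
    have t: "0 < t" using False r by (simp add: t_def)
    have "norm (- t *\<^sub>R w) < r" using False r by (simp add: t_def)
    moreover have "- t *\<^sub>R w \<in> L" using E_L[OF w] L(1) unfolding L_def by (rule subspace_scale[rotated])
    ultimately obtain \<beta> where \<beta>: "(- t *\<^sub>R w, \<beta>) \<in> E" "\<beta> \<le> B" using bound by blast
    have "(t / (1 + t)) *\<^sub>R (w, \<alpha>) + (1 / (1 + t)) *\<^sub>R (- t *\<^sub>R w, \<beta>) \<in> E"
      using t by (intro convexD[OF \<open>convex E\<close> w \<beta>(1)]) (auto simp: add_divide_distrib[symmetric])
    then have "0 \<le> (t / (1 + t)) * \<alpha> + (1 / (1 + t)) * \<beta>" by (intro zero) simp
    also have "\<dots> = (t * \<alpha> + \<beta>) / (1 + t)" by (simp add: add_divide_distrib)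
    finally have "0 \<le> t * \<alpha> + B" using t \<beta>(2) by (simp add: zero_le_divide_iff)
    then have "- B / t \<le> \<alpha>" using t by (simp add: field_simps)
    moreover have "- B / t = - (2 * B / r) * norm w" using False r by (simp add: t_def)
    ultimately show ?thesis by simp
  qed
  obtain v :: "'z \<Rightarrow>\<^sub>L real" where v: "\<And>w \<alpha>. (w, \<alpha>) \<in> E \<Longrightarrow> v w \<le> \<alpha>"
    using convex_calm_minorant[OF \<open>convex E\<close> _ calm] B r by auto
  have key: "v (z - z0) - (\<alpha> - a) + (zs - v) (c - z0) \<le> \<epsilon>" if "\<phi> z \<le> ereal \<alpha>" "c \<in> C" for z c \<alpha>
    using v[OF in_E[OF that]] by (simp add: blinfun.bilinear_simps)
  define S where "S = {v (z - z0) - (\<alpha> - a) | z \<alpha>. \<phi> z \<le> ereal \<alpha>}"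
  define \<gamma> where "\<gamma> = Sup S"
  have S0: "0 \<in> S" unfolding S_def using z0(2) by (force intro: exI[of _ z0] exI[of _ a])
  have S_le: "s \<le> \<epsilon> - (zs - v) (c - z0)" if "s \<in> S" "c \<in> C" for s c
    using that key by (fastforce simp: S_def)
  have bdd: "bdd_above S" using S_le[OF _ z0(1)] by (rule bdd_aboveI)
  have "0 \<le> \<gamma>" unfolding \<gamma>_def by (rule cSup_upper[OF S0 bdd])
  have N: "(zs - v) (c - z0) \<le> \<epsilon> - \<gamma>" if "c \<in> C" for c
    using cSup_least[of S "\<epsilon> - (zs - v) (c - z0)"] S0 S_le that unfolding \<gamma>_def by fastforce
  have "v \<in> eps_subdiff \<gamma> \<phi> z0"
    unfolding eps_subdiff_epigraph_iff[of \<phi>, OF z0(2)]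
  proof (intro allI impI)
    fix z \<alpha> assume "\<phi> z \<le> ereal \<alpha>"
    then have "v (z - z0) - (\<alpha> - a) \<le> \<gamma>" unfolding \<gamma>_def by (intro cSup_upper bdd) (auto simp: S_def)
    then show "v (z - z0) \<le> \<alpha> - a + \<gamma>" by simp
  qed
  moreover have "zs - v \<in> eps_normal (\<epsilon> - \<gamma>) z0 C" using N z0(1) by (simp add: eps_normal_def)
  ultimately have "v + (zs - v) \<in> eps_subdiff \<gamma> \<phi> z0 + eps_normal (\<epsilon> - \<gamma>) z0 C" by (rule set_plus_intro)
  moreover have "(\<gamma>, \<epsilon> - \<gamma>) \<in> splits \<epsilon>" using \<open>0 \<le> \<gamma>\<close> N[OF z0(1)] by (simp add: splits_def)
  ultimately show ?thesis using that by simp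
qed

section \<open>Subgradients of the marginal function\<close>

lemma marginal_le: "y \<in> G x \<Longrightarrow> marginal \<phi> G x \<le> \<phi> (x, y)"
  unfolding marginal_def by (rule INF_lower)

lemma marginal_less_iff: "marginal \<phi> G x < b \<longleftrightarrow> (\<exists>y\<in>G x. \<phi> (x, y) < b)"
  unfolding marginal_def by (rule INF_less_iff)

text \<open>
  The slack \<open>e\<close> is shared equally between the choice of a nearly optimal \<open>y'\<close> at \<open>x\<close> and the
  parameter \<open>\<eta>\<close> of the splitting at \<open>x0\<close>.
\<close>

lemma eps_subdiff_marginalI:
  fixes G :: "'a::real_normed_vector \<Rightarrow> 'b::real_normed_vector set"
  assumes m: "marginal \<phi> G x0 = ereal m" and "eproper \<phi>"
    and split: "\<And>\<eta>. 0 < \<eta> \<Longrightarrow> \<exists>y \<gamma>\<^sub>1 \<gamma>\<^sub>2. (\<gamma>\<^sub>1, \<gamma>\<^sub>2) \<in> splits (\<eta> + \<epsilon>) \<and>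
      dual_pair xs 0 \<in> eps_subdiff \<gamma>\<^sub>1 \<phi> (x0, y) + eps_normal \<gamma>\<^sub>2 (x0, y) (gph G)"
  shows "xs \<in> eps_subdiff \<epsilon> (marginal \<phi> G) x0"
  unfolding eps_subdiff_epigraph_iff[of "marginal \<phi> G", OF m]
proof (intro allI impI)
  fix x \<alpha> assume \<alpha>: "marginal \<phi> G x \<le> ereal \<alpha>"
  show "xs (x - x0) \<le> \<alpha> - m + \<epsilon>"
  proof (rule field_le_epsilon)
    fix e :: real assume e: "0 < e"
    have "marginal \<phi> G x < ereal (\<alpha> + e / 2)" using \<alpha> e by (auto intro: le_less_trans)
    then obtain y' where y': "y' \<in> G x" "\<phi> (x, y') \<le> ereal (\<alpha> + e / 2)"
      unfolding marginal_less_iff by (auto intro: less_imp_le)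
    obtain y \<gamma>\<^sub>1 \<gamma>\<^sub>2 u v where \<gamma>: "(\<gamma>\<^sub>1, \<gamma>\<^sub>2) \<in> splits (e / 2 + \<epsilon>)" "dual_pair xs 0 = u + v"
      and u: "u \<in> eps_subdiff \<gamma>\<^sub>1 \<phi> (x0, y)" and v: "v \<in> eps_normal \<gamma>\<^sub>2 (x0, y) (gph G)"
      using split[of "e / 2"] e by (auto simp: set_plus_def)
    have y: "(x0, y) \<in> gph G" using v by (auto simp: eps_normal_def split: if_splits)
    have "(x0, y) \<in> edom \<phi>" using u by (auto simp: eps_subdiff_def split: if_splits)
    then obtain a where a: "\<phi> (x0, y) = ereal a"
      using \<open>eproper \<phi>\<close> by (cases "\<phi> (x0, y)") (auto simp: edom_def eproper_def)
    have "m \<le> a" using marginal_le[of y G x0 \<phi>] y m a by (simp add: gph_def)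
    have "u ((x, y') - (x0, y)) \<le> \<alpha> + e / 2 - a + \<gamma>\<^sub>1"
      using u y'(2) unfolding eps_subdiff_epigraph_iff[of \<phi>, OF a] by blast
    moreover have "v ((x, y') - (x0, y)) \<le> \<gamma>\<^sub>2"
      using v y'(1) by (auto simp: eps_normal_def gph_def split: if_splits)
    moreover have "xs (x - x0) = u ((x, y') - (x0, y)) + v ((x, y') - (x0, y))"
      unfolding blinfun.add_left[symmetric] \<gamma>(2)[symmetric] by (simp add: dual_pair_apply)
    ultimately show "xs (x - x0) \<le> \<alpha> - m + \<epsilon> + e"
      using \<gamma>(1) \<open>m \<le> a\<close> by (simp add: splits_def)
  qed
qed

lemma approx_sol_nonempty:
  assumes "marginal \<phi> G x = ereal m" "0 < \<eta>"
  shows "approx_sol \<phi> G \<eta> x \<noteq> {}"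
proof -
  have "marginal \<phi> G x < ereal (m + \<eta>)" using assms by simp
  then obtain y where "y \<in> G x" "\<phi> (x, y) < ereal (m + \<eta>)" unfolding marginal_less_iff by blast
  then show ?thesis using assms(1) by (auto simp: approx_sol_def intro: less_imp_le)
qed

theorem theorem4p3:
  fixes G :: "'a::banach \<Rightarrow> 'b::banach set"
    and \<phi> :: "'a \<times> 'b \<Rightarrow> ereal"
    and x0 :: 'a
    and \<epsilon> :: real
  assumes "convex_multifunction G" and "closed (gph G)"
    and "eproper \<phi>" and "eclosed \<phi>" and "econvex \<phi>"
    and "\<bar>marginal \<phi> G x0\<bar> \<noteq> \<infinity>"
    and "(subspace (generated_cone (minkowski_diff (edom \<phi>) (gph G)))
            \<and> closed (generated_cone (minkowski_diff (edom \<phi>) (gph G))))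
         \<or> (0, 0) \<in> interior (minkowski_diff (edom \<phi>) (gph G))"
    and "0 \<le> \<epsilon>"
  shows "eps_subdiff \<epsilon> (marginal \<phi> G) x0 =
      (\<Inter>\<eta>\<in>{0<..}. \<Inter>y\<in>approx_sol \<phi> G \<eta> x0. \<Union>(\<gamma>\<^sub>1, \<gamma>\<^sub>2)\<in>splits (\<eta> + \<epsilon>).
        {xs. dual_pair xs 0 \<in> eps_subdiff \<gamma>\<^sub>1 \<phi> (x0, y) + eps_normal \<gamma>\<^sub>2 (x0, y) (gph G)})
    \<and> eps_subdiff \<epsilon> (marginal \<phi> G) x0 =
      (\<Inter>\<eta>\<in>{0<..}. \<Union>y. \<Union>(\<gamma>\<^sub>1, \<gamma>\<^sub>2)\<in>splits (\<eta> + \<epsilon>).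
        {xs. dual_pair xs 0 \<in> eps_subdiff \<gamma>\<^sub>1 \<phi> (x0, y) + eps_normal \<gamma>\<^sub>2 (x0, y) (gph G)})"
    (is "?S = (\<Inter>\<eta>\<in>_. \<Inter>y\<in>?M \<eta>. ?U \<eta> y) \<and> _")
proof -
  obtain m where m: "marginal \<phi> G x0 = ereal m" using assms(6) by auto
  \<comment> \<open>If \<open>0\<close> is interior to the difference set, the cone that this set generates is the whole space.\<close>
  have cone: "subspace (generated_cone (minkowski_diff (edom \<phi>) (gph G)))
      \<and> closed (generated_cone (minkowski_diff (edom \<phi>) (gph G)))"
    using assms(7) generated_cone_eq_UNIV[of "minkowski_diff (edom \<phi>) (gph G)"]
    by (auto simp: zero_prod_def)
  have subset_all: "?S \<subseteq> (\<Inter>\<eta>\<in>{0<..}. \<Inter>y\<in>?M \<eta>. ?U \<eta> y)"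
  proof (intro subsetI INT_I)
    fix xs \<eta> y assume xs: "xs \<in> ?S" and y: "y \<in> ?M \<eta>"
    have yG: "(x0, y) \<in> gph G" and ym: "\<phi> (x0, y) \<le> ereal (m + \<eta>)"
      using y m by (auto simp: approx_sol_def gph_def)
    obtain a where a: "\<phi> (x0, y) = ereal a" "a \<le> m + \<eta>"
      using ym assms(3) by (cases "\<phi> (x0, y)") (auto simp: eproper_def)
    have "blinfun_apply (dual_pair xs 0) (z - (x0, y)) \<le> \<alpha> - a + (\<eta> + \<epsilon>)"
      if z: "z \<in> gph G" "\<phi> z \<le> ereal \<alpha>" for z \<alpha>
    proof -
      obtain x y' where xy: "z = (x, y')" by fastforce
      have "marginal \<phi> G x \<le> ereal \<alpha>"
        using z marginal_le[of y' G x \<phi>] by (auto simp: xy gph_def intro: order_trans)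
      then have "xs (x - x0) \<le> \<alpha> - m + \<epsilon>"
        using xs unfolding eps_subdiff_epigraph_iff[of "marginal \<phi> G", OF m] by blast
      then show ?thesis using a(2) by (simp add: xy dual_pair_apply)
    qed
    then obtain \<gamma>\<^sub>1 \<gamma>\<^sub>2 where "(\<gamma>\<^sub>1, \<gamma>\<^sub>2) \<in> splits (\<eta> + \<epsilon>)"
      "dual_pair xs 0 \<in> eps_subdiff \<gamma>\<^sub>1 \<phi> (x0, y) + eps_normal \<gamma>\<^sub>2 (x0, y) (gph G)"
      using eps_subdiff_indicator_sum_rule[OF assms(1)[unfolded convex_multifunction_def] assms(2-5)
          yG a(1) conjunct1[OF cone] conjunct2[OF cone], of "dual_pair xs 0" "\<eta> + \<epsilon>"] by blast
    then show "xs \<in> ?U \<eta> y" by auto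
  qed
  have all_subset_some: "(\<Inter>\<eta>\<in>{0<..}. \<Inter>y\<in>?M \<eta>. ?U \<eta> y) \<subseteq> (\<Inter>\<eta>\<in>{0<..}. \<Union>y. ?U \<eta> y)"
  proof (intro subsetI INT_I)
    fix xs \<eta> assume xs: "xs \<in> (\<Inter>\<eta>\<in>{0<..}. \<Inter>y\<in>?M \<eta>. ?U \<eta> y)" and \<eta>: "\<eta> \<in> {0::real<..}"
    then obtain y where "y \<in> ?M \<eta>" using approx_sol_nonempty[OF m, of \<eta>] by auto
    then have "xs \<in> ?U \<eta> y" using INT_D[OF INT_D[OF xs \<eta>]] by blast
    then show "xs \<in> (\<Union>y. ?U \<eta> y)" by (rule UN_I[OF UNIV_I])
  qed
  have some_subset: "(\<Inter>\<eta>\<in>{0<..}. \<Union>y. ?U \<eta> y) \<subseteq> ?S"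
  proof
    fix xs assume xs: "xs \<in> (\<Inter>\<eta>\<in>{0<..}. \<Union>y. ?U \<eta> y)"
    show "xs \<in> ?S"
    proof (rule eps_subdiff_marginalI[OF m assms(3)])
      fix \<eta> :: real assume "0 < \<eta>"
      then have "xs \<in> (\<Union>y. ?U \<eta> y)" using xs by blast
      then show "\<exists>y \<gamma>\<^sub>1 \<gamma>\<^sub>2. (\<gamma>\<^sub>1, \<gamma>\<^sub>2) \<in> splits (\<eta> + \<epsilon>) \<and>
          dual_pair xs 0 \<in> eps_subdiff \<gamma>\<^sub>1 \<phi> (x0, y) + eps_normal \<gamma>\<^sub>2 (x0, y) (gph G)"
        by auto
    qed
  qed
  show ?thesis
    by (intro conjI equalityI subset_all some_subset
        subset_trans[OF subset_all all_subset_some] subset_trans[OF all_subset_some some_subset])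
qed

end
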